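(* Let $B_1,B_2\in sl(2,\mathbb{R})$. There exists $K\in SL^{\pm}(2)$ such that $KA_1K^{-1}=B_1$ and $KA_2K^{-1}=B_2$ if and only if the coordinate vectors of $B_1$ and $B_2$ in the basis $\{A_0,A_1,A_2\}$ are, respectively, the second and third columns of a real $3\times3$ matrix $X$ satisfying $X^TI_{1,2}X=I_{1,2}$ and $\det X=1$.
   Context: $A_0=\frac12\begin{pmatrix}0&-1\\1&0\end{pmatrix}$, $A_1=\frac12\begin{pmatrix}0&1\\1&0\end{pmatrix}$, $A_2=\frac12\begin{pmatrix}1&0\\0&-1\end{pmatrix}$ is a basis of $sl(2,\mathbb{R})$. $SL^{\pm}(2)$ is the group of real $2\times2$ matrices with determinant $\pm1$. $I_{1,2}=\mathrm{diag}(-1,1,1)$. (A pair $\{B_1,B_2\}$ defines a right invariant sub-Riemannian structure on $SL(2,\mathbb{R})$ with orthonormal frame the right invariant vector fields associated with $B_1,B_2$; the condition on $K$ says that this structure is related by a group automorphism to the one defined by $\{A_1,A_2\}$.) *)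

theory Defs
  imports "HOL-Analysis.Analysis"
begin

definition sl2 :: "(real^2^2) set" where
  "sl2 = {A. trace A = 0}"

definition SLpm2 :: "(real^2^2) set" where
  "SLpm2 = {K. det K = 1 \<or> det K = -1}"

definition A0 :: "real^2^2" where
  "A0 = (1/2) *\<^sub>R vector [vector [0, -1], vector [1, 0]]"

definition A1 :: "real^2^2" where
  "A1 = (1/2) *\<^sub>R vector [vector [0, 1], vector [1, 0]]"

definition A2 :: "real^2^2" where
  "A2 = (1/2) *\<^sub>R vector [vector [1, 0], vector [0, -1]]"

text \<open>The index type \<open>3\<close> has elements \<open>1\<close>, \<open>2\<close>, \<open>3\<close>, with \<open>3 = 0\<close>; the components of the
  ordered basis and of the coordinate vectors are numbered from \<open>1\<close>, so that \<open>A0\<close>, \<open>A1\<close>, \<open>A2\<close>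
  have positions \<open>1\<close>, \<open>2\<close>, \<open>3\<close>.\<close>

definition sl2_basis :: "real^2^2^3" where
  "sl2_basis = vector [A0, A1, A2]"

definition sl2_coords :: "real^2^2 \<Rightarrow> real^3" where
  "sl2_coords B = (\<chi> i. representation {A0, A1, A2} B (sl2_basis $ i))"

definition I12 :: "real^3^3" where
  "I12 = vector [vector [-1, 0, 0], vector [0, 1, 0], vector [0, 0, 1]]"

lemmas A_defs = A0_def A1_def A2_def

lemma A_distinct: "A0 \<noteq> A1" "A0 \<noteq> A2" "A1 \<noteq> A2"
  by (auto simp: A_defs vec_eq_iff forall_2)

lemma A_combination:
  "a *\<^sub>R A0 + b *\<^sub>R A1 + c *\<^sub>R A2 =
     vector [vector [c / 2, (b - a) / 2], vector [(a + b) / 2, - c / 2]]"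
  by (simp add: A_defs vec_eq_iff forall_2 field_simps)

lemma independent_A: "independent {A0, A1, A2}"
proof (rule independent_if_scalars_zero)
  fix f x
  assume "(\<Sum>x\<in>{A0, A1, A2}. f x *\<^sub>R x) = 0" and x: "x \<in> {A0, A1, A2}"
  then have "f A0 *\<^sub>R A0 + f A1 *\<^sub>R A1 + f A2 *\<^sub>R A2 = 0"
    by (simp add: A_distinct add.assoc)
  then have "f A0 = 0 \<and> f A1 = 0 \<and> f A2 = 0"
    unfolding A_combination by (simp add: vec_eq_iff forall_2)
  with x show "f x = 0" by auto
qed simp

lemma sl2_coords_combination:
  "sl2_coords (a *\<^sub>R A0 + b *\<^sub>R A1 + c *\<^sub>R A2) = vector [a, b, c]"
proof -
  have s: "A0 \<in> span {A0, A1, A2}" "A1 \<in> span {A0, A1, A2}" "A2 \<in> span {A0, A1, A2}"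
    by (auto intro: span_base)
  have r: "representation {A0, A1, A2} (a *\<^sub>R A0 + b *\<^sub>R A1 + c *\<^sub>R A2) =
      (\<lambda>v. a * (if v = A0 then 1 else 0) + b * (if v = A1 then 1 else 0)
        + c * (if v = A2 then 1 else 0))"
    by (rule ext)
      (simp add: representation_add representation_scale representation_basis independent_A s
        span_add span_scale)
  show ?thesis
    unfolding vec_eq_iff[where 'a = real and 'b = 3] forall_3 sl2_coords_def r sl2_basis_def
    using A_distinct by simp
qed

lemma sl2_eq_combination:
  assumes "B \<in> sl2"
  shows "B = (B$2$1 - B$1$2) *\<^sub>R A0 + (B$1$2 + B$2$1) *\<^sub>R A1 + (2 * B$1$1) *\<^sub>R A2"
  using assms unfolding A_combination
  by (simp add: sl2_def trace_def sum_2 vec_eq_iff forall_2 field_simps)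

lemma span_A: "span {A0, A1, A2} = sl2"
proof
  have "subspace sl2"
    by (auto simp: sl2_def subspace_def trace_def sum_2 simp flip: distrib_left)
  moreover have "{A0, A1, A2} \<subseteq> sl2"
    by (auto simp: sl2_def A_defs trace_def sum_2)
  ultimately show "span {A0, A1, A2} \<subseteq> sl2" by (rule span_minimal[rotated])
  show "sl2 \<subseteq> span {A0, A1, A2}"
  proof
    fix B assume "B \<in> sl2"
    from sl2_eq_combination[OF this] show "B \<in> span {A0, A1, A2}"
      by (metis insertCI span_add span_base span_scale)
  qed
qed

end

(* Conjugation by K with det K = 1 or -1 preserves the trace form, which has matrix I12 / 2 in the
   basis A0, A1, A2; and Ad K has determinant (det K)^6 = 1.  Conversely, orthonormality of the
   last two columns of X says that (2 B1)^2 = (2 B2)^2 = 1 and that B1 and B2 anticommute.  Let v be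
   an eigenvector of 2 B2 for the eigenvalue 1.  Then w = 2 B1 v is an eigenvector for -1 and
   2 B1 w = v, so the matrix with columns v, w conjugates A1, A2 to B1, B2, and it can be rescaled
   to have determinant 1 or -1. *)

theory Submission
  imports Defs
begin

lemma sl2_coords_eq:
  assumes "B \<in> sl2"
  shows "sl2_coords B = vector [B$2$1 - B$1$2, B$1$2 + B$2$1, 2 * B$1$1]"
  by (subst sl2_eq_combination[OF assms], rule sl2_coords_combination)

lemma matrix_inv_inverse:
  fixes K :: "'a::semiring_1^'n^'m"
  assumes "invertible K"
  shows "K ** matrix_inv K = mat 1" "matrix_inv K ** K = mat 1"
  using someI_ex[OF assms[unfolded invertible_def]] by (simp_all add: matrix_inv_def)

text \<open>The inverse is the adjugate divided by \<open>det K\<close>. For determinant 1 or -1 the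
  division is a multiplication by \<open>det K\<close>, so the entries stay polynomial.\<close>

lemma matrix_inv_2_unimodular:
  fixes K :: "real^2^2"
  assumes "det K = 1 \<or> det K = -1"
  shows "matrix_inv K = det K *\<^sub>R vector [vector [K$2$2, - K$1$2], vector [- K$2$1, K$1$1]]"
proof -
  let ?L = "det K *\<^sub>R vector [vector [K$2$2, - K$1$2], vector [- K$2$1, K$1$1]] :: real^2^2"
  have "det K * det K = 1" using assms by auto
  then have "K ** ?L = mat 1"
    by (simp add: vec_eq_iff forall_2 matrix_matrix_mult_def sum_2 mat_def det_2) algebra
  then have L: "?L ** K = mat 1"
    using matrix_left_right_inverse by blast
  have "matrix_inv K = (?L ** K) ** matrix_inv K"
    by (simp only: L matrix_mul_lid)
  also have "\<dots> = ?L"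
  proof -
    have "invertible K" using assms by (auto simp: invertible_det_nz)
    then show ?thesis
      by (simp only: matrix_inv_inverse(1) matrix_mul_rid flip: matrix_mul_assoc)
  qed
  finally show ?thesis .
qed

text \<open>The intertwining form is linear in \<open>K\<close>, so it can be checked column by
  column and survives rescaling of \<open>K\<close>.\<close>

lemma conj_eq_iff_intertwines:
  fixes K A B :: "real^'n^'n"
  assumes "invertible K"
  shows "K ** A ** matrix_inv K = B \<longleftrightarrow> K ** A = B ** K"
proof
  assume "K ** A ** matrix_inv K = B"
  then show "K ** A = B ** K"
    by (metis assms matrix_inv_inverse(2) matrix_mul_assoc matrix_mul_rid)
next
  assume "K ** A = B ** K"
  then show "K ** A ** matrix_inv K = B"
    by (metis assms matrix_inv_inverse(1) matrix_mul_assoc matrix_mul_rid)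
qed

text \<open>Scaling a 2 by 2 matrix by \<open>t\<close> multiplies its determinant by the square of
  \<open>t\<close>. The absolute value can thus be normalised but not the sign, whence
  \<open>SLpm2\<close>.\<close>

lemma exists_SLpm2_scaling:
  fixes K :: "real^2^2"
  assumes "det K \<noteq> 0"
  shows "\<exists>t. t *\<^sub>R K \<in> SLpm2"
proof
  let ?t = "1 / sqrt \<bar>det K\<bar>"
  have "det (t *\<^sub>R K) = t\<^sup>2 * det K" for t
    by (simp add: det_2 power2_eq_square algebra_simps)
  then have "det (?t *\<^sub>R K) = ?t\<^sup>2 * det K" .
  also have "\<dots> = sgn (det K)"
    using assms by (cases "det K > 0") (simp_all add: power_divide)
  finally show "?t *\<^sub>R K \<in> SLpm2"
    using assms by (auto simp: SLpm2_def sgn_real_def)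
qed

lemma Lorentz_matrix_of_conjugation:
  fixes K :: "real^2^2"
  assumes "K \<in> SLpm2"
  shows "\<exists>X :: real^3^3. transpose X ** I12 ** X = I12 \<and> det X = 1 \<and>
    sl2_coords (K ** A1 ** matrix_inv K) = column 2 X \<and>
    sl2_coords (K ** A2 ** matrix_inv K) = column 3 X"
proof -
  define p q r s where "p = K$1$1" and "q = K$1$2" and "r = K$2$1" and "s = K$2$2"
  define d where "d = det K"
  have K: "K$1$1 = p" "K$1$2 = q" "K$2$1 = r" "K$2$2 = s"
    by (simp_all add: p_def q_def r_def s_def)
  have d: "d = p * s - q * r" by (simp add: d_def det_2 K)
  have dd: "d * d = 1" using assms by (auto simp: d_def SLpm2_def)
  have inv: "matrix_inv K = d *\<^sub>R vector [vector [s, - q], vector [- r, p]]"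
    using matrix_inv_2_unimodular[of K] assms by (simp add: d_def K SLpm2_def)
  \<comment> \<open>The columns are the coordinates of the conjugates by \<open>K\<close> of
    \<open>A0\<close>, \<open>A1\<close>, \<open>A2\<close>, in this order.\<close>
  define X :: "real^3^3" where "X = vector [
    vector [d * (p * p + q * q + r * r + s * s) / 2, d * (s * s - r * r - p * p + q * q) / 2, d * (r * s + p * q)],
    vector [d * (r * r + s * s - p * p - q * q) / 2, d * (p * p - q * q + s * s - r * r) / 2, d * (r * s - p * q)],
    vector [d * (q * s + p * r), d * (q * s - p * r), d * (p * s + q * r)]]"
  have sl: "K ** A1 ** matrix_inv K \<in> sl2" "K ** A2 ** matrix_inv K \<in> sl2"
    by (simp_all add: inv sl2_def trace_def matrix_matrix_mult_def sum_2 A_defs K algebra_simps)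
  have "sl2_coords (K ** A1 ** matrix_inv K) = column 2 X"
    unfolding sl2_coords_eq[OF sl(1)]
    by (simp add: inv X_def column_def vec_eq_iff forall_3 matrix_matrix_mult_def sum_2 A_defs K
        field_simps)
  moreover have "sl2_coords (K ** A2 ** matrix_inv K) = column 3 X"
    unfolding sl2_coords_eq[OF sl(2)]
    by (simp add: inv X_def column_def vec_eq_iff forall_3 matrix_matrix_mult_def sum_2 A_defs K
        field_simps)
  moreover have "transpose X ** I12 ** X = I12"
  proof -
    \<comment> \<open>A polynomial identity with \<open>d\<close> treated as a free variable.
      Substituting \<open>d\<close> for \<open>p * s - q * r\<close> afterwards turns the factor
      into the fourth power of \<open>d\<close>.\<close>
    have "transpose X ** I12 ** X = (d * d * (p * s - q * r) * (p * s - q * r)) *\<^sub>R I12"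
      by (simp add: X_def I12_def transpose_def vec_eq_iff forall_3 matrix_matrix_mult_def sum_3
          field_simps)
    with dd show ?thesis by (simp flip: d)
  qed
  moreover have "det X = 1"
  proof -
    have "det X = d * d * d * (p * s - q * r) * (p * s - q * r) * (p * s - q * r)"
      by (simp add: X_def det_3 field_simps)
    also have "\<dots> = 1"
      using dd by (simp flip: d)
    finally show ?thesis .
  qed
  ultimately show ?thesis by blast
qed

text \<open>The assumed relations are those that \<open>A1\<close> and \<open>A2\<close> satisfy
  themselves; they determine the pair up to conjugation.\<close>

lemma exists_conjugating_matrix:
  fixes B1 B2 :: "real^2^2"
  assumes sl: "B1 \<in> sl2" "B2 \<in> sl2"
    and sq: "B1 ** B1 = (1/4) *\<^sub>R mat 1" "B2 ** B2 = (1/4) *\<^sub>R mat 1"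
    and anti: "B1 ** B2 = - (B2 ** B1)"
  shows "\<exists>K\<in>SLpm2. K ** A1 ** matrix_inv K = B1 \<and> K ** A2 ** matrix_inv K = B2"
proof -
  have sq1: "B1 *v (B1 *v u) = (1/4) *\<^sub>R u" and sq2: "B2 *v (B2 *v u) = (1/4) *\<^sub>R u" for u
    by (simp_all add: matrix_vector_mul_assoc sq scaleR_matrix_vector_assoc [symmetric])
  have ac: "B2 *v (B1 *v u) = - (B1 *v (B2 *v u))" for u
    by (simp add: matrix_vector_mul_assoc anti)
       (simp add: matrix_vector_mult_def vec_eq_iff sum_negf)
  obtain v where v: "v \<noteq> 0" "B2 *v v = (1/2) *\<^sub>R v"
  proof -
    \<comment> \<open>The matrix \<open>mat 1 + 2 *\<^sub>R B2\<close> maps into the eigenspace of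
      \<open>B2\<close> for 1/2. It is nonzero, since its trace is 2.\<close>
    have "\<exists>e. e + 2 *\<^sub>R (B2 *v e) \<noteq> 0"
    proof (rule ccontr)
      assume "\<nexists>e. e + 2 *\<^sub>R (B2 *v e) \<noteq> 0"
      then have "(axis 1 1 + 2 *\<^sub>R (B2 *v axis 1 1))$1 = 0" "(axis 2 1 + 2 *\<^sub>R (B2 *v axis 2 1))$2 = 0"
        by simp_all
      then have "1 + 2 * B2$1$1 = 0" "1 + 2 * B2$2$2 = 0"
        by (simp_all add: matrix_vector_mult_def sum_2 axis_def)
      with sl(2) show False by (simp add: sl2_def trace_def sum_2)
    qed
    then obtain e where "e + 2 *\<^sub>R (B2 *v e) \<noteq> 0" ..
    moreover have "B2 *v (e + 2 *\<^sub>R (B2 *v e)) = (1/2) *\<^sub>R (e + 2 *\<^sub>R (B2 *v e))"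
      by (simp add: matrix_vector_right_distrib matrix_vector_mult_scaleR sq2 algebra_simps)
    ultimately show thesis by (rule that)
  qed
  define w where "w = 2 *\<^sub>R (B1 *v v)"
  have w: "B2 *v w = - (1/2) *\<^sub>R w" and wv: "B1 *v w = (1/2) *\<^sub>R v" and vw: "B1 *v v = (1/2) *\<^sub>R w"
    by (simp_all add: w_def matrix_vector_mult_scaleR ac v sq1)
  \<comment> \<open>On the standard basis \<open>A1\<close> is half the swap and \<open>A2\<close>
    is diagonal with entries 1/2 and -1/2, just as \<open>B1\<close> and \<open>B2\<close> act on
    \<open>v\<close>, \<open>w\<close>.\<close>
  define K :: "real^2^2" where "K = vector [vector [v$1, w$1], vector [v$2, w$2]]"
  have "K ** A1 = B1 ** K" "K ** A2 = B2 ** K"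
    using v(2) w wv vw
    by (simp_all add: K_def A_defs vec_eq_iff forall_2 matrix_matrix_mult_def
        matrix_vector_mult_def sum_2)
  then have KA: "(t *\<^sub>R K) ** A1 = B1 ** (t *\<^sub>R K)" "(t *\<^sub>R K) ** A2 = B2 ** (t *\<^sub>R K)" for t
    by (simp_all add: matrix_scalar_ac flip: scalar_matrix_assoc)
  have "det K \<noteq> 0"
  proof
    assume "det K = 0"
    then have 0: "v$1 * w$2 = w$1 * v$2" by (simp add: K_def det_2)
    have "(v$1) *\<^sub>R w = (w$1) *\<^sub>R v" "(v$2) *\<^sub>R w = (w$2) *\<^sub>R v"
      using 0 by (simp_all add: vec_eq_iff forall_2 mult.commute)
    then obtain i where i: "v$i \<noteq> 0" "(v$i) *\<^sub>R w = (w$i) *\<^sub>R v"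
      using v(1) unfolding vec_eq_iff[of v] forall_2 zero_index by blast
    \<comment> \<open>Parallel \<open>v\<close> and \<open>w\<close> would be scaled by
      \<open>B2\<close> with different eigenvalues, which forces \<open>w = 0\<close> and then
      \<open>v = 0\<close>.\<close>
    have "- (1/2) *\<^sub>R (v$i) *\<^sub>R w = B2 *v ((v$i) *\<^sub>R w)"
      unfolding matrix_vector_mult_scaleR w by simp
    also have "\<dots> = (1/2) *\<^sub>R (v$i) *\<^sub>R w"
      unfolding i matrix_vector_mult_scaleR v by simp
    finally have "(- (1/2) * v$i - (1/2) * v$i) *\<^sub>R w = 0"
      unfolding scaleR_scaleR scaleR_left_diff_distrib by simp
    with i(1) have "w = 0" by simp
    with wv v(1) show False by simp
  qed
  then obtain t where t: "t *\<^sub>R K \<in> SLpm2"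
    using exists_SLpm2_scaling by blast
  then have "invertible (t *\<^sub>R K)"
    by (auto simp: SLpm2_def invertible_det_nz)
  with KA t show ?thesis
    using conj_eq_iff_intertwines by blast
qed

theorem mainTheorem4:
  fixes B1 B2 :: "real^2^2"
  assumes "B1 \<in> sl2" and "B2 \<in> sl2"
  shows "(\<exists>K\<in>SLpm2. K ** A1 ** matrix_inv K = B1 \<and> K ** A2 ** matrix_inv K = B2) \<longleftrightarrow>
    (\<exists>X :: real^3^3. transpose X ** I12 ** X = I12 \<and> det X = 1 \<and>
       sl2_coords B1 = column 2 X \<and> sl2_coords B2 = column 3 X)"
proof
  assume "\<exists>K\<in>SLpm2. K ** A1 ** matrix_inv K = B1 \<and> K ** A2 ** matrix_inv K = B2"
  then show "\<exists>X :: real^3^3. transpose X ** I12 ** X = I12 \<and> det X = 1 \<and>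
       sl2_coords B1 = column 2 X \<and> sl2_coords B2 = column 3 X"
    using Lorentz_matrix_of_conjugation by blast
next
  assume "\<exists>X :: real^3^3. transpose X ** I12 ** X = I12 \<and> det X = 1 \<and>
       sl2_coords B1 = column 2 X \<and> sl2_coords B2 = column 3 X"
  then obtain X :: "real^3^3" where X: "transpose X ** I12 ** X = I12"
    and c: "sl2_coords B1 = column 2 X" "sl2_coords B2 = column 3 X" by blast
  have X_eq: "X$1$2 = B1$2$1 - B1$1$2" "X$2$2 = B1$1$2 + B1$2$1" "X$3$2 = 2 * B1$1$1"
       "X$1$3 = B2$2$1 - B2$1$2" "X$2$3 = B2$1$2 + B2$2$1" "X$3$3 = 2 * B2$1$1"
    using c by (simp_all add: sl2_coords_eq assms vec_eq_iff forall_3 column_def)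
  \<comment> \<open>These entries are the Lorentz products of the coordinate vectors of
    \<open>B1\<close> and \<open>B2\<close>.\<close>
  have "(transpose X ** I12 ** X)$2$2 = 1" "(transpose X ** I12 ** X)$3$3 = 1"
    "(transpose X ** I12 ** X)$2$3 = 0"
    unfolding X by (simp_all add: I12_def)
  then have o: "4 * (B1$1$1 * B1$1$1 + B1$1$2 * B1$2$1) = 1"
      "4 * (B2$1$1 * B2$1$1 + B2$1$2 * B2$2$1) = 1"
      "2 * B1$1$1 * B2$1$1 + B1$1$2 * B2$2$1 + B1$2$1 * B2$1$2 = 0"
    by (simp_all add: I12_def transpose_def matrix_matrix_mult_def sum_3 X_eq algebra_simps)
  have tr: "B1$2$2 = - B1$1$1" "B2$2$2 = - B2$1$1"
    using assms by (simp_all add: sl2_def trace_def sum_2)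
  \<comment> \<open>For traceless 2 by 2 matrices, Cayley-Hamilton makes each square and the
    anticommutator scalar matrices, so the three scalar equations \<open>o\<close> suffice.\<close>
  have "B1 ** B1 = (1/4) *\<^sub>R mat 1" "B2 ** B2 = (1/4) *\<^sub>R mat 1" "B1 ** B2 = - (B2 ** B1)"
    using o by (simp_all add: vec_eq_iff forall_2 matrix_matrix_mult_def sum_2 mat_def tr
        algebra_simps)
  with assms show "\<exists>K\<in>SLpm2. K ** A1 ** matrix_inv K = B1 \<and> K ** A2 ** matrix_inv K = B2"
    by (rule exists_conjugating_matrix)
qed

end
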